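(* Let $\mu$ be a finite positive Borel measure on $[0,1)$, and for $1<p<\infty$ let $p'$ be defined by $\frac1p+\frac1{p'}=1$. (i) If $1<p\le2$ and $\sum_{k=1}^\infty\frac{\mu_k^{p'}}{k}<\infty$, then the operator $\mathcal H_\mu$ is well defined in $B^p$. (ii) If $2<p<\infty$ and $\sum_{k=1}^\infty\frac{\mu_k^{p'}}{k^{p'/p}}<\infty$, then the operator $\mathcal H_\mu$ is well defined in $B^p$.
   Context: $\mathbb D=\{z\in\mathbb C:|z|<1\}$, and $dA(z)=\frac{dx\,dy}{\pi}$. For $1<p<\infty$ the analytic Besov space $B^p$ is the set of analytic functions $f$ in $\mathbb D$ with $\|f\|_{B^p}=\left(|f(0)|^p+\rho_p(f)^p\right)^{1/p}<\infty$, where $\rho_p(f)=\left(\int_{\mathbb D}(1-|z|^2)^{p-2}|f'(z)|^p\,dA(z)\right)^{1/p}$. The moments of $\mu$ are $\mu_n=\int_{[0,1)}t^n\,d\mu(t)$, $n=0,1,2,\dots$. For $f(z)=\sum_{k\ge0}a_kz^k$ analytic in $\mathbb D$, $$\mathcal H_\mu(f)(z)=\sum_{n=0}^\infty\Big(\sum_{k=0}^\infty\mu_{n+k}a_k\Big)z^n,$$ whenever the right-hand side makes sense (all series converge) and defines an analytic function in $\mathbb D$; $\mathcal H_\mu$ is well defined in a space if this is the case for every $f$ in the space. *)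

theory Defs
  imports "HOL-Complex_Analysis.Complex_Analysis"
begin

abbreviation unit_disc :: "complex set"
  where "unit_disc \<equiv> ball 0 1"

text \<open>Normalized area measure, giving the unit disc total mass 1.\<close>

definition dA :: "complex measure"
  where "dA = scale_measure (ennreal (1 / pi)) lborel"

text \<open>Real powers of extended nonnegative reals, meant for a positive exponent.\<close>

definition epowr :: "ennreal \<Rightarrow> real \<Rightarrow> ennreal"
  where "epowr x a = (if x = \<infinity> then \<infinity> else ennreal (enn2real x powr a))"

definition besov_rho :: "real \<Rightarrow> (complex \<Rightarrow> complex) \<Rightarrow> ennreal"
  where "besov_rho p f =
    epowr (\<integral>\<^sup>+z\<in>unit_disc. ennreal ((1 - (cmod z)\<^sup>2) powr (p - 2) * cmod (deriv f z) powr p) \<partial>dA) (1 / p)"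

definition besov_norm :: "real \<Rightarrow> (complex \<Rightarrow> complex) \<Rightarrow> ennreal"
  where "besov_norm p f = epowr (ennreal (cmod (f 0) powr p) + epowr (besov_rho p f) p) (1 / p)"

text \<open>Functions on the disc are represented by total functions on the complex plane; the values
  outside the disc are arbitrary and play no role.\<close>

definition besov_space :: "real \<Rightarrow> (complex \<Rightarrow> complex) set"
  where "besov_space p = {f. f holomorphic_on unit_disc \<and> besov_norm p f < \<infinity>}"

definition moment :: "real measure \<Rightarrow> nat \<Rightarrow> real"
  where "moment \<mu> n = (\<integral>t. t ^ n \<partial>\<mu>)"

definition hankel_coeff_term :: "real measure \<Rightarrow> (complex \<Rightarrow> complex) \<Rightarrow> nat \<Rightarrow> nat \<Rightarrow> complex"
  where "hankel_coeff_term \<mu> f n k = of_real (moment \<mu> (n + k)) * fps_nth (fps_expansion f 0) k"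

definition hankel_op :: "real measure \<Rightarrow> (complex \<Rightarrow> complex) \<Rightarrow> complex \<Rightarrow> complex"
  where "hankel_op \<mu> f z = (\<Sum>n. (\<Sum>k. hankel_coeff_term \<mu> f n k) * z ^ n)"

text \<open>Since \<^const>\<open>suminf\<close> is total, convergence of both the inner and the outer series has to be
  demanded separately.\<close>

definition hankel_well_defined_at :: "real measure \<Rightarrow> (complex \<Rightarrow> complex) \<Rightarrow> bool"
  where "hankel_well_defined_at \<mu> f \<longleftrightarrow>
    (\<forall>n. summable (hankel_coeff_term \<mu> f n)) \<and>
    (\<forall>z\<in>unit_disc. summable (\<lambda>n. (\<Sum>k. hankel_coeff_term \<mu> f n k) * z ^ n)) \<and>
    hankel_op \<mu> f holomorphic_on unit_disc"

definition hankel_well_defined_in :: "real measure \<Rightarrow> (complex \<Rightarrow> complex) set \<Rightarrow> bool"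
  where "hankel_well_defined_in \<mu> X \<longleftrightarrow> (\<forall>f\<in>X. hankel_well_defined_at \<mu> f)"

end

theory Submission
  imports Defs
begin

text \<open>
  Let \<open>a k\<close> be the Taylor coefficients of \<open>f\<close>. Moments of a measure on \<open>[0, 1)\<close>
  decrease, so every series defining a coefficient of the image is dominated by the single series with terms
  \<open>\<mu>\<^sub>k \<bar>a k\<bar>\<close>. If it converges, the coefficients of the image are bounded and the
  image is holomorphic in the disc. The whole problem is therefore the convergence of that series.

  The monotonicity of the moments has a second use: the series may be estimated over the dyadic blocks
  \<open>2 ^ j \<le> k < 2 ^ (j + 1)\<close>, on which each moment is at most the one at the left end point. Write
  \<open>b k = (k + 1) a (k + 1)\<close> for the coefficients of the derivative \<open>g\<close>, and
  \<open>T\<^sub>j\<close> for the sum of \<open>\<bar>b k\<bar> / (k + 1)\<close> over a block. On the annulus where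
  \<open>1 - \<bar>z\<bar>\<close> is comparable to \<open>\<delta> = 2 ^ (-j)\<close> the monomials of the block have
  size comparable to 1. Bessel's inequality on the annulus, whose area is comparable to \<open>\<delta>\<close>, and
  the Cauchy-Schwarz inequality give that the square of \<open>T\<^sub>j\<close> is at most a constant times the
  integral of \<open>\<bar>g\<bar>\<^sup>2\<close> over the annulus (\<open>dyadic_block_square_le\<close>).

  It remains to pass from exponent 2 to exponent \<open>p\<close> (\<open>annulus_square_integral_powr_le\<close>).
  For \<open>p \<ge> 2\<close> this is the power mean inequality. For \<open>p < 2\<close> one splits off
  \<open>\<bar>g\<bar>\<close> to the power \<open>2 - p\<close> and bounds it by the mean value inequality over discs
  of radius comparable to \<open>\<delta>\<close>. After inserting the Besov weight, the \<open>p\<close>-th power of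
  \<open>T\<^sub>j\<close> is at most a constant times \<open>2 ^ (j \<kappa>) E\<^sub>j\<close>, where
  \<open>\<kappa>\<close> is the positive part of \<open>p - 2\<close> and \<open>E\<^sub>j\<close> is the part of the
  Besov integral over a slightly larger annulus (\<open>dyadic_block_powr_le\<close>). These annuli overlap boundedly,
  so the \<open>E\<^sub>j\<close> are summable.

  Cauchy condensation turns both hypotheses on the moments into the summability of \<open>2 ^ (j s)\<close> times the
  \<open>p'\<close>-th power of the moment of index \<open>2 ^ j\<close>, with \<open>s = \<kappa> p' / p\<close>.
  Young's inequality for the exponents \<open>p\<close> and \<open>p'\<close> then sums the products of
  \<open>T\<^sub>j\<close> with the moment of index \<open>2 ^ j\<close>
  (\<open>besov_series_absolutely_summable\<close>).
\<close>

section \<open>Rotation invariance of planar Lebesgue measure\<close>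

text \<open>
  Lebesgue measure and its image under \<open>T\<close> are both translation invariant, hence proportional: Fubini's
  theorem applied to the set of all \<open>(x, y)\<close> with \<open>T x \<in> A\<close> and
  \<open>T x + y \<in> B\<close> expresses its measure in two ways. Taking the unit ball for \<open>A\<close> shows
  that the factor is 1, because \<open>T\<close> preserves that ball; its symmetry under
  \<open>y \<mapsto> - y\<close> is used as well.
\<close>

lemma lborel_distr_linear_isometry:
  fixes T :: "'a::euclidean_space \<Rightarrow> 'a"
  assumes lin: "linear T" and iso: "\<And>x. norm (T x) = norm x"
  shows "distr lborel borel T = lborel"
proof (rule measure_eqI)
  have [measurable]: "T \<in> borel_measurable borel"
    using lin by (simp add: borel_measurable_continuous_onI linear_continuous_on linear_conv_bounded_linear)
  have "inj T"
    using lin iso by (metis linear_injective_0 norm_eq_zero)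
  then have "surj T"
    using lin linear_injective_imp_surjective by blast
  show "sets (distr lborel borel T) = sets (lborel :: 'a measure)" by simp
  fix B assume "B \<in> sets (distr lborel borel T)"
  then have B[measurable]: "B \<in> sets borel" by simp
  define A where "A = ball (0::'a) 1"
  have A[measurable]: "A \<in> sets borel" by (simp add: A_def)
  define J where "J = (\<integral>\<^sup>+y. \<integral>\<^sup>+x. indicator A (T x) * indicator B (T x + y) \<partial>lborel \<partial>lborel)"
  have shift: "(\<integral>\<^sup>+y. h (c + y) \<partial>lborel) = (\<integral>\<^sup>+y. h y \<partial>lborel)"
    if [measurable]: "h \<in> borel_measurable borel" for h :: "'a \<Rightarrow> ennreal" and c
  proof -
    have "(\<integral>\<^sup>+y. h y \<partial>lborel) = (\<integral>\<^sup>+y. h y \<partial>distr lborel borel ((+) c))"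
      by (simp add: lborel_distr_plus)
    also have "\<dots> = (\<integral>\<^sup>+y. h (c + y) \<partial>lborel)"
      by (subst nn_integral_distr) auto
    finally show ?thesis by simp
  qed
  have "J = (\<integral>\<^sup>+x. \<integral>\<^sup>+y. indicator A (T x) * indicator B (T x + y) \<partial>lborel \<partial>lborel)"
    unfolding J_def by (rule lborel_pair.Fubini') measurable
  also have "\<dots> = (\<integral>\<^sup>+x. indicator A (T x) * emeasure lborel B \<partial>lborel)"
    by (simp add: nn_integral_cmult shift[of "indicator B"])
  also have "\<dots> = emeasure lborel A * emeasure lborel B"
  proof -
    have "(indicator A (T x) :: ennreal) = indicator A x" for x
      using iso by (simp add: A_def indicator_def)
    then show ?thesis by (simp add: nn_integral_multc)
  qed
  finally have 1: "J = emeasure lborel A * emeasure lborel B" .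
  have "(\<integral>\<^sup>+x. indicator A (T x) * indicator B (T x + y) \<partial>lborel) =
      (\<integral>\<^sup>+x. indicator A (T x - y) * indicator B (T x) \<partial>lborel)" for y
  proof -
    obtain u where u: "y = T u" using \<open>surj T\<close> by (metis surjD)
    show ?thesis
      using shift[of "\<lambda>x. indicator A (T x - y) * indicator B (T x)" u] lin
      by (simp add: u linear_add add.commute)
  qed
  then have "J = (\<integral>\<^sup>+y. \<integral>\<^sup>+x. indicator A (T x - y) * indicator B (T x) \<partial>lborel \<partial>lborel)"
    by (simp add: J_def)
  also have "\<dots> = (\<integral>\<^sup>+x. \<integral>\<^sup>+y. indicator A (T x - y) * indicator B (T x) \<partial>lborel \<partial>lborel)"
    by (rule lborel_pair.Fubini') measurable
  also have "\<dots> = (\<integral>\<^sup>+x. emeasure lborel A * indicator B (T x) \<partial>lborel)"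
  proof (rule nn_integral_cong)
    fix x
    have "(indicator A (T x - y) :: ennreal) = indicator (ball (T x) 1) y" for y
      by (auto simp: A_def indicator_def dist_norm norm_minus_commute)
    moreover have "emeasure lborel (ball (T x) 1) = emeasure lborel A"
      by (simp add: A_def emeasure_ball)
    moreover have "(\<integral>\<^sup>+y. indicator (ball (T x) 1) y * indicator B (T x) \<partial>lborel) =
        emeasure lborel (ball (T x) 1) * indicator B (T x)"
      by (subst nn_integral_multc) (auto intro!: borel_measurable_indicator)
    ultimately show "(\<integral>\<^sup>+y. indicator A (T x - y) * indicator B (T x) \<partial>lborel) =
        emeasure lborel A * indicator B (T x)"
      by simp
  qed
  also have "\<dots> = emeasure lborel A * emeasure (distr lborel borel T) B"
  proof -
    have "(\<integral>\<^sup>+x. indicator B (T x) \<partial>lborel) = (\<integral>\<^sup>+x. indicator B x \<partial>distr lborel borel T)"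
      by (rule nn_integral_distr[symmetric]) auto
    then show ?thesis by (simp add: nn_integral_cmult)
  qed
  finally have "emeasure lborel A * emeasure (distr lborel borel T) B = emeasure lborel A * emeasure lborel B"
    using 1 by simp
  moreover have "emeasure lborel A \<noteq> 0" "emeasure lborel A \<noteq> \<infinity>"
  proof -
    show "emeasure lborel A \<noteq> 0"
      using content_ball_gt_0_iff[of "0::'a" 1] unfolding A_def measure_def by (metis enn2real_0 less_irrefl zero_less_one)
    show "emeasure lborel A \<noteq> \<infinity>"
      using emeasure_lborel_ball_finite[of "0::'a" 1] unfolding A_def by (simp add: less_top)
  qed
  ultimately show "emeasure (distr lborel borel T) B = emeasure lborel B"
    by (simp add: ennreal_mult_cancel_left)
qed

lemma integral_lborel_rotate:
  fixes h :: "complex \<Rightarrow> complex"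
  assumes [measurable]: "h \<in> borel_measurable borel" and "cmod c = 1"
  shows "(\<integral>z. h (c * z) \<partial>lborel) = (\<integral>z. h z \<partial>lborel)"
proof -
  have "distr lborel borel ((*) c) = lborel"
    using assms by (intro lborel_distr_linear_isometry)
      (auto simp: norm_mult intro!: linearI simp: algebra_simps)
  then have "(\<integral>z. h z \<partial>lborel) = (\<integral>z. h z \<partial>distr lborel borel ((*) c))"
    by simp
  also have "\<dots> = (\<integral>z. h (c * z) \<partial>lborel)"
    by (subst integral_distr) auto
  finally show ?thesis by simp
qed

definition rotation_invariant :: "complex set \<Rightarrow> bool"
  where "rotation_invariant S \<longleftrightarrow> (\<forall>c z. cmod c = 1 \<longrightarrow> z \<in> S \<longrightarrow> c * z \<in> S)"

lemma rotation_invariant_iff: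
  assumes "rotation_invariant S" "cmod c = 1"
  shows "c * z \<in> S \<longleftrightarrow> z \<in> S"
proof
  assume "c * z \<in> S"
  moreover from assms(2) have "c \<noteq> 0" "cmod (inverse c) = 1"
    by (auto simp: norm_inverse)
  moreover from this have "inverse c * (c * z) = z" by simp
  ultimately show "z \<in> S"
    using assms(1) unfolding rotation_invariant_def by metis
qed (use assms in \<open>auto simp: rotation_invariant_def\<close>)

lemma set_integral_monomials_orthogonal:
  assumes [measurable]: "S \<in> sets borel" and S: "rotation_invariant S" and "m \<noteq> k"
  shows "(LINT z:S|lborel. z ^ m * cnj z ^ k) = 0"
proof -
  \<comment> \<open>the rotation that turns the integrand into its negative\<close>
  define c where "c = cis (pi / (real m - real k))"
  have c: "cmod c = 1" by (simp add: c_def)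
  have "c ^ m * cnj c ^ k = cis ((real m - real k) * (pi / (real m - real k)))"
    by (simp add: c_def cis_cnj Complex.DeMoivre cis_mult cis_divide left_diff_distrib diff_divide_distrib)
  also have "\<dots> = -1" using \<open>m \<noteq> k\<close> by simp
  finally have neg: "c ^ m * cnj c ^ k = -1" .
  let ?h = "\<lambda>z. indicator S z *\<^sub>R (z ^ m * cnj z ^ k)"
  have "?h (c * z) = (c ^ m * cnj c ^ k) * ?h z" for z
    using rotation_invariant_iff[OF S c, of z] by (cases "z \<in> S") (auto simp: power_mult_distrib)
  then have "(\<integral>z. ?h (c * z) \<partial>lborel) = - (\<integral>z. ?h z \<partial>lborel)"
    by (simp add: neg)
  moreover have "(\<integral>z. ?h (c * z) \<partial>lborel) = (\<integral>z. ?h z \<partial>lborel)"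
    by (intro integral_lborel_rotate borel_measurable_continuous_on_indicator continuous_intros c) auto
  ultimately show ?thesis
    by (simp add: set_lebesgue_integral_def)
qed

section \<open>Power series over rotation invariant sets\<close>

lemma set_integrable_compact_subset:
  fixes h :: "'a::euclidean_space \<Rightarrow> 'b::{banach, second_countable_topology}"
  assumes "compact K" "continuous_on K h" "S \<in> sets borel" "S \<subseteq> K"
  shows "set_integrable lborel S h"
proof (rule set_integrable_subset)
  show "set_integrable lborel K h"
    using borel_integrable_compact[OF assms(1,2)] by (simp add: set_integrable_def)
qed (use assms in auto)

lemma set_integral_mono_set:
  fixes h :: "'a \<Rightarrow> real"
  assumes "set_integrable M B h" "A \<in> sets M" "A \<subseteq> B" "\<And>x. x \<in> B \<Longrightarrow> 0 \<le> h x"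
  shows "(LINT x:A|M. h x) \<le> (LINT x:B|M. h x)"
  using assms set_integrable_subset[OF assms(1-3)]
  unfolding set_lebesgue_integral_def set_integrable_def
  by (intro integral_mono) (auto simp: indicator_def)

lemma continuous_on_norm_powr:
  fixes g :: "'a::topological_space \<Rightarrow> 'b::real_normed_vector"
  assumes "continuous_on S g" "0 < p"
  shows "continuous_on S (\<lambda>x. norm (g x) powr p)"
  using assms by (intro continuous_on_powr' continuous_intros) auto

text \<open>
  Integrating termwise, orthogonality leaves only the term of index \<open>k\<close>. For a disc and
  \<open>k = 0\<close> this is the area mean value property, for an annulus it provides the Fourier coefficients
  needed for Bessel's inequality.
\<close>

lemma integral_power_series_times_conj_monomial:
  fixes b :: "nat \<Rightarrow> complex"
  assumes S: "S \<in> sets borel" "rotation_invariant S" "S \<subseteq> cball 0 r"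
    and r: "0 \<le> r" "summable (\<lambda>m. cmod (b m) * r ^ m)"
    and g: "\<And>z. z \<in> S \<Longrightarrow> (\<lambda>m. b m * z ^ m) sums g z"
  shows "(LINT z:S|lborel. g z * cnj z ^ k) =
    b k * of_real (LINT z:S|lborel. cmod z ^ (2 * k))"
proof -
  let ?f = "\<lambda>m z. indicator S z *\<^sub>R (b m * (z ^ m * cnj z ^ k))"
  have int: "set_integrable lborel S (\<lambda>z. z ^ m * cnj z ^ k)" for m
    using S by (intro set_integrable_compact_subset[of "cball 0 r"] continuous_intros) auto
  have int_f: "integrable lborel (?f m)" for m
    using set_integrable_mult_right[OF int, of "b m" m] by (simp add: set_integrable_def)
  have fin: "integrable lborel (indicator S :: complex \<Rightarrow> real)"
    using S(1,3) set_integrable_compact_subset[of "cball 0 r" "\<lambda>_. 1::real" S]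
    by (simp add: set_integrable_def)
  have bound: "norm (?f m z) \<le> indicator S z * (cmod (b m) * r ^ m * r ^ k)" for m z
  proof (cases "z \<in> S")
    case True
    then have "cmod z \<le> r" using S(3) by auto
    then show ?thesis using True r(1)
      by (simp add: norm_mult norm_power mult.assoc mult_left_mono mult_mono power_mono)
  qed simp
  have summ: "summable (\<lambda>m. norm (?f m z))" for z
    by (rule summable_comparison_test'[OF summable_mult[OF summable_mult2[OF r(2)]]])
      (use bound in auto)
  have "summable (\<lambda>m. \<integral>z. norm (?f m z) \<partial>lborel)"
  proof (rule summable_comparison_test')
    show "summable (\<lambda>m. (\<integral>z. indicator S z \<partial>lborel) * (cmod (b m) * r ^ m * r ^ k))"
      by (intro summable_mult summable_mult2 r)
    fix m :: nat
    have "(\<integral>z. norm (?f m z) \<partial>lborel) \<le> (\<integral>z. indicator S z * (cmod (b m) * r ^ m * r ^ k) \<partial>lborel)"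
      using int_f fin by (intro integral_mono bound integrable_norm integrable_mult_left) auto
    then show "norm (\<integral>z. norm (?f m z) \<partial>lborel) \<le>
        (\<integral>z. indicator S z \<partial>lborel) * (cmod (b m) * r ^ m * r ^ k)"
      by simp
  qed
  then have "(\<lambda>m. \<integral>z. ?f m z \<partial>lborel) sums (\<integral>z. (\<Sum>m. ?f m z) \<partial>lborel)"
    using summ int_f by (intro sums_integral) auto
  moreover have "(\<Sum>m. ?f m z) = indicator S z *\<^sub>R (g z * cnj z ^ k)" for z
  proof (cases "z \<in> S")
    case True
    then show ?thesis
      using sums_unique[OF sums_mult2[OF g[OF True], of "cnj z ^ k"]] by (simp add: mult_ac)
  qed simp
  moreover have "(\<integral>z. ?f m z \<partial>lborel) =
      (if m = k then b k * of_real (LINT z:S|lborel. cmod z ^ (2 * k)) else 0)" for m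
  proof -
    have "(\<integral>z. ?f m z \<partial>lborel) = b m * (LINT z:S|lborel. z ^ m * cnj z ^ k)"
      unfolding set_lebesgue_integral_def mult_scaleR_right[symmetric] by (rule integral_mult_right_zero)
    moreover have "(LINT z:S|lborel. z ^ k * cnj z ^ k) = of_real (LINT z:S|lborel. cmod z ^ (2 * k))"
      unfolding set_integral_complex_of_real[symmetric]
      by (intro arg_cong[of _ _ "set_lebesgue_integral lborel S"])
         (simp add: fun_eq_iff power_mult flip: power_mult_distrib complex_norm_square)
    ultimately show ?thesis
      using set_integral_monomials_orthogonal[OF S(1,2), of m k] by auto
  qed
  ultimately have "(\<lambda>m. if m = k then b k * of_real (LINT z:S|lborel. cmod z ^ (2 * k)) else 0)
      sums (LINT z:S|lborel. g z * cnj z ^ k)"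
    by (simp add: set_lebesgue_integral_def)
  from sums_unique2[OF this sums_single] show ?thesis .
qed

lemma bessel_inequality_rotation_invariant:
  fixes b :: "nat \<Rightarrow> complex"
  assumes S: "S \<in> sets borel" "rotation_invariant S" "S \<subseteq> cball 0 r"
    and r: "0 \<le> r" "summable (\<lambda>m. cmod (b m) * r ^ m)"
    and g: "\<And>z. z \<in> S \<Longrightarrow> (\<lambda>m. b m * z ^ m) sums g z" "continuous_on (cball 0 r) g"
    and K: "finite K"
  shows "(\<Sum>k\<in>K. (cmod (b k))\<^sup>2 * (LINT z:S|lborel. cmod z ^ (2 * k))) \<le>
    (LINT z:S|lborel. (cmod (g z))\<^sup>2)"
proof -
  define P where "P z = (\<Sum>k\<in>K. b k * z ^ k)" for z
  define w where "w k = (LINT z:S|lborel. cmod z ^ (2 * k))" for k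
  note int = set_integrable_compact_subset[OF compact_cball _ S(1,3)]
  have cont [continuous_intros]: "continuous_on (cball 0 r) P"
    unfolding P_def by (intro continuous_intros)
  have pair: "(LINT z:S|lborel. h z * cnj (P z)) = of_real (\<Sum>k\<in>K. (cmod (b k))\<^sup>2 * w k)"
    if h: "continuous_on (cball 0 r) h"
      and c: "summable (\<lambda>m. cmod (c m) * r ^ m)"
        "\<And>z. z \<in> S \<Longrightarrow> (\<lambda>m. c m * z ^ m) sums h z"
      and cb: "\<And>k. k \<in> K \<Longrightarrow> c k = b k" for h c
  proof -
    have "(LINT z:S|lborel. h z * cnj (P z)) =
        (LINT z:S|lborel. (\<Sum>k\<in>K. cnj (b k) * (h z * cnj z ^ k)))"
      by (simp add: P_def sum_distrib_left mult_ac)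
    also have "\<dots> = (\<Sum>k\<in>K. LINT z:S|lborel. cnj (b k) * (h z * cnj z ^ k))"
      unfolding set_lebesgue_integral_def scaleR_sum_right
    proof (rule Bochner_Integration.integral_sum)
      fix k
      have "set_integrable lborel S (\<lambda>z. cnj (b k) * (h z * cnj z ^ k))"
        by (intro int continuous_intros h)
      then show "integrable lborel (\<lambda>z. indicator S z *\<^sub>R (cnj (b k) * (h z * cnj z ^ k)))"
        by (simp add: set_integrable_def)
    qed
    also have "\<dots> = (\<Sum>k\<in>K. cnj (b k) * (b k * of_real (w k)))"
      by (intro sum.cong refl)
         (simp add: integral_power_series_times_conj_monomial[OF S r(1) c] cb w_def)
    also have "\<dots> = of_real (\<Sum>k\<in>K. (cmod (b k))\<^sup>2 * w k)"
      unfolding of_real_sum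
      by (intro sum.cong refl) (simp add: complex_norm_square mult_ac del: of_real_power)
    finally show ?thesis .
  qed
  define c where "c m = (if m \<in> K then b m else 0)" for m
  have gP: "(LINT z:S|lborel. g z * cnj (P z)) = of_real (\<Sum>k\<in>K. (cmod (b k))\<^sup>2 * w k)"
    by (rule pair[OF g(2) r(2) g(1)]) auto
  have PP: "(LINT z:S|lborel. P z * cnj (P z)) = of_real (\<Sum>k\<in>K. (cmod (b k))\<^sup>2 * w k)"
  proof (rule pair[OF cont, of c])
    show "summable (\<lambda>m. cmod (c m) * r ^ m)"
      by (rule summable_finite[OF K]) (auto simp: c_def)
    show "(\<lambda>m. c m * z ^ m) sums P z" for z
      using sums_If_finite_set[OF K, of "\<lambda>m. b m * z ^ m"]
      by (simp add: c_def P_def if_distrib if_distribR cong: if_cong)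
  qed (simp add: c_def)
  have re: "(LINT z:S|lborel. Re (h z)) = Re (LINT z:S|lborel. h z)"
    if "continuous_on (cball 0 r) h" for h
    using integral_Re[of lborel "\<lambda>z. indicator S z *\<^sub>R h z"] int[OF that]
    by (simp add: set_lebesgue_integral_def set_integrable_def)
  \<comment> \<open>integrate the pointwise inequality expressing that the square of |g - P| is nonnegative\<close>
  have "(LINT z:S|lborel. 2 * Re (g z * cnj (P z)) - Re (P z * cnj (P z))) \<le>
      (LINT z:S|lborel. (cmod (g z))\<^sup>2)"
  proof (intro set_integral_mono int continuous_intros g(2))
    fix z
    have "0 \<le> (cmod (g z - P z))\<^sup>2" by simp
    then show "2 * Re (g z * cnj (P z)) - Re (P z * cnj (P z)) \<le> (cmod (g z))\<^sup>2"
      unfolding cmod_power2 by (simp add: power2_eq_square algebra_simps)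
  qed
  also have "(LINT z:S|lborel. 2 * Re (g z * cnj (P z)) - Re (P z * cnj (P z))) =
     2 * (LINT z:S|lborel. Re (g z * cnj (P z))) - (LINT z:S|lborel. Re (P z * cnj (P z)))"
    unfolding set_integral_mult_right[symmetric]
    by (rule set_integral_diff) (intro int continuous_intros g(2))+
  also have "\<dots> = (\<Sum>k\<in>K. (cmod (b k))\<^sup>2 * w k)"
    using gP PP by (subst (1 2) re) (auto intro!: continuous_intros g(2))
  finally show ?thesis by (simp add: w_def)
qed

section \<open>Area means of powers\<close>

text \<open>
  Jensen's inequality for the power function, in the unnormalized form that allows any set of finite positive measure.
\<close>

lemma set_integral_powr_power_mean:
  fixes h :: "'a \<Rightarrow> real"
  assumes p: "1 \<le> p" and h: "\<And>x. x \<in> S \<Longrightarrow> 0 \<le> h x"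
    and S: "S \<in> sets M" "emeasure M S < \<infinity>" "0 < measure M S"
    and int: "set_integrable M S h" "set_integrable M S (\<lambda>x. h x powr p)"
  shows "(LINT x:S|M. h x) powr p \<le> measure M S powr (p - 1) * (LINT x:S|M. h x powr p)"
proof (cases "p = 1 \<or> (LINT x:S|M. h x) \<le> 0")
  case True
  moreover have "0 \<le> (LINT x:S|M. h x)" "0 \<le> (LINT x:S|M. h x powr p)"
    using h by (auto simp: set_lebesgue_integral_def indicator_def intro!: Bochner_Integration.integral_nonneg)
  moreover have "(LINT x:S|M. h x powr 1) = (LINT x:S|M. h x)"
    using h by (intro set_lebesgue_integral_cong) (use S in auto)
  ultimately show ?thesis
    using S(3) True by (cases "p = 1") (simp, simp add: antisym[of _ "0::real"])
next
  case False
  then have p1: "1 < p" using p by simp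
  define A where "A = measure M S"
  define m where "m = (LINT x:S|M. h x) / A"
  have A: "0 < A" using S by (simp add: A_def)
  have m: "0 < m" "(LINT x:S|M. h x) = A * m" using False A by (auto simp: m_def)
  have const: "set_integrable M S (\<lambda>_. c)" for c :: real
    using S by (simp add: set_integrable_def)
  \<comment> \<open>integrate the tangent line inequality at the mean value\<close>
  have "(LINT x:S|M. h x * m powr (p - 1)) \<le> (LINT x:S|M. h x powr p / p + m powr p * (1 - 1 / p))"
  proof (intro set_integral_mono set_integral_add int const set_integrable_divide set_integrable_mult_left impI)
    fix x assume "x \<in> S"
    have "h x * m powr (p - 1) \<le> h x powr p / p + (m powr (p - 1)) powr (p / (p - 1)) / (p / (p - 1))"
      using p1 h[OF \<open>x \<in> S\<close>] m by (intro Youngs_inequality) (auto simp: field_simps)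
    also have "\<dots> = h x powr p / p + m powr p * (1 - 1 / p)"
    proof -
      have "(p - 1) * (p / (p - 1)) = p" "1 / (p / (p - 1)) = 1 - 1 / p"
        using p1 by (simp_all add: field_simps)
      then have "h x powr p / p + (m powr (p - 1)) powr (p / (p - 1)) / (p / (p - 1)) =
          h x powr p / p + m powr p * (1 / (p / (p - 1)))"
        unfolding powr_powr by (metis times_divide_eq_right mult.right_neutral)
      then show ?thesis by (simp only: \<open>1 / (p / (p - 1)) = 1 - 1 / p\<close>)
    qed
    finally show "h x * m powr (p - 1) \<le> h x powr p / p + m powr p * (1 - 1 / p)" .
  qed
  also have "(LINT x:S|M. h x powr p / p + m powr p * (1 - 1 / p)) =
      (LINT x:S|M. h x powr p) / p + A * (m powr p * (1 - 1 / p))"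
    using S by (subst set_integral_add) (auto intro!: int const simp: set_lebesgue_integral_def A_def)
  also have "(LINT x:S|M. h x * m powr (p - 1)) = A * m powr p"
    using m by (simp add: powr_diff)
  finally have "A * m powr p \<le> (LINT x:S|M. h x powr p)"
    using p1 by (simp add: field_simps)
  then have "A powr (p - 1) * (A * m powr p) \<le> A powr (p - 1) * (LINT x:S|M. h x powr p)"
    by (intro mult_left_mono) auto
  moreover have "A powr (p - 1) * (A * m powr p) = (A * m) powr p"
    using A m by (simp add: powr_mult powr_diff)
  ultimately show ?thesis using m by (simp add: A_def)
qed

lemma content_disc:
  fixes a :: complex
  shows "0 \<le> r \<Longrightarrow> measure lborel (cball a r) = pi * r\<^sup>2"
  by (simp add: content_cball unit_ball_vol_2)

lemma holomorphic_power_series_summable_norm: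
  assumes "g holomorphic_on ball a R" "0 \<le> r" "r < R"
  shows "summable (\<lambda>m. cmod ((deriv ^^ m) g a / fact m) * r ^ m)"
proof -
  define s where "s = (r + R) / 2"
  have s: "r < s" "s < R" "0 < s" using assms by (auto simp: s_def)
  have "summable (\<lambda>m. (deriv ^^ m) g a / fact m * of_real s ^ m)"
    using holomorphic_power_series[OF assms(1), of "a + of_real s"] s
    by (auto simp: sums_iff dist_norm)
  from powser_insidea[OF this, of "of_real r"] s assms(2)
  show ?thesis by (simp add: norm_mult norm_divide norm_power)
qed

text \<open>
  The mean value property over the disc bounds \<open>\<bar>g a\<bar>\<close> by the mean of
  \<open>\<bar>g\<bar>\<close>, and the power mean inequality raises this to the exponent \<open>p\<close>.
\<close>

lemma holomorphic_area_mean_value: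
  assumes g: "g holomorphic_on ball a R" and r: "0 < r" "r < R" and p: "1 \<le> p"
  shows "pi * r\<^sup>2 * cmod (g a) powr p \<le> (LINT z:cball a r|lborel. cmod (g z) powr p)"
proof -
  define h where "h z = g (a + z)" for z
  have h: "h holomorphic_on ball 0 R"
    unfolding h_def
    by (rule holomorphic_on_compose_gen[of "\<lambda>z. a + z" _ g "ball a R", unfolded o_def])
       (auto intro!: holomorphic_intros g simp: dist_norm)
  have sub: "cball 0 r \<subseteq> ball (0::complex) R" using r by auto
  have cont: "continuous_on (cball 0 r) h"
    using h sub holomorphic_on_imp_continuous_on holomorphic_on_subset by blast
  have shift: "(LINT z:cball a r|lborel. cmod (g z) powr p) = (LINT z:cball 0 r|lborel. cmod (h z) powr p)"
  proof -
    let ?f = "\<lambda>z. indicator (cball a r) z *\<^sub>R (cmod (g z) powr p)"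
    have "continuous_on (cball a r) g"
      using r by (intro holomorphic_on_imp_continuous_on holomorphic_on_subset[OF g]) auto
    then have meas: "?f \<in> borel_measurable borel"
      using p by (intro borel_measurable_continuous_on_indicator continuous_on_norm_powr) auto
    have "(\<integral>z. ?f z \<partial>lborel) = (\<integral>z. ?f z \<partial>distr lborel borel ((+) a))"
      by (simp add: lborel_distr_plus)
    also have "\<dots> = (\<integral>z. ?f (a + z) \<partial>lborel)"
      by (rule integral_distr[OF _ meas]) auto
    also have "(\<lambda>z. ?f (a + z)) = (\<lambda>z. indicator (cball 0 r) z *\<^sub>R (cmod (h z) powr p))"
      by (auto simp: fun_eq_iff indicator_def h_def dist_norm)
    finally show ?thesis by (simp add: set_lebesgue_integral_def)
  qed
  have A: "measure lborel (cball (0::complex) r) = pi * r\<^sup>2"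
    using r by (simp add: content_disc)
  have "(LINT z:cball 0 r|lborel. h z * cnj z ^ 0) =
      ((deriv ^^ 0) h 0 / fact 0) * of_real (LINT z:cball 0 r|lborel. cmod z ^ (2 * 0))"
  proof (rule integral_power_series_times_conj_monomial[of _ r])
    show "rotation_invariant (cball 0 r)" by (auto simp: rotation_invariant_def norm_mult)
    show "(\<lambda>m. (deriv ^^ m) h 0 / fact m * z ^ m) sums h z" if "z \<in> cball 0 r" for z
      using holomorphic_power_series[OF h, of z] that sub by auto
  qed (use r holomorphic_power_series_summable_norm[OF h] in auto)
  then have mean: "(LINT z:cball 0 r|lborel. h z) = h 0 * of_real (pi * r\<^sup>2)"
    using A by (simp add: set_lebesgue_integral_def)
  have int: "set_integrable lborel (cball 0 r) h" 
    "set_integrable lborel (cball 0 r) (\<lambda>z. cmod (h z))"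
    "set_integrable lborel (cball 0 r) (\<lambda>z. cmod (h z) powr p)"
    using p cont by (auto intro!: set_integrable_compact_subset[of "cball 0 r"] continuous_on_norm_powr continuous_intros)
  have "cmod (h 0) * (pi * r\<^sup>2) = cmod (LINT z:cball 0 r|lborel. h z)"
    using r by (simp add: mean norm_mult norm_power)
  also have "\<dots> \<le> (LINT z:cball 0 r|lborel. cmod (h z))"
    by (rule set_integral_norm_bound[OF int(1)])
  finally have "(cmod (h 0) * (pi * r\<^sup>2)) powr p \<le> (LINT z:cball 0 r|lborel. cmod (h z)) powr p"
    using r p by (intro powr_mono2) auto
  also have "\<dots> \<le> (pi * r\<^sup>2) powr (p - 1) * (LINT z:cball 0 r|lborel. cmod (h z) powr p)"
    using set_integral_powr_power_mean[OF p, of "cball 0 r" "\<lambda>z. cmod (h z)" lborel] int A r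
    using emeasure_lborel_cball_finite[of "0::complex" r] by simp
  also have "(cmod (h 0) * (pi * r\<^sup>2)) powr p = (pi * r\<^sup>2) powr (p - 1) * (pi * r\<^sup>2 * cmod (h 0) powr p)"
    using r by (simp add: powr_mult powr_diff)
  finally have "pi * r\<^sup>2 * cmod (h 0) powr p \<le> (LINT z:cball 0 r|lborel. cmod (h z) powr p)"
    using r by (subst (asm) mult_le_cancel_left_pos) auto
  then show ?thesis by (simp add: shift h_def)
qed

section \<open>Dyadic annuli and dyadic blocks of coefficients\<close>

text \<open>
  The half-open bounds make these annuli a partition of the punctured disc.
\<close>

definition dyadic_annulus :: "nat \<Rightarrow> complex set"
  where "dyadic_annulus j = {z. (1/2) ^ Suc j \<le> 1 - cmod z \<and> 1 - cmod z < (1/2) ^ j}"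

lemma dyadic_annulus_eq_Diff:
  "dyadic_annulus j = cball 0 (1 - (1/2) ^ Suc j) - cball 0 (1 - (1/2) ^ j)"
  by (auto simp: dyadic_annulus_def)

lemma sets_dyadic_annulus [measurable, simp]: "dyadic_annulus j \<in> sets borel"
  unfolding dyadic_annulus_eq_Diff by measurable

lemma rotation_invariant_dyadic_annulus: "rotation_invariant (dyadic_annulus j)"
  by (auto simp: rotation_invariant_def dyadic_annulus_def norm_mult)

lemma dyadic_annulus_subset_cball: "dyadic_annulus j \<subseteq> cball 0 (1 - (1/2) ^ Suc j)"
  by (auto simp: dyadic_annulus_def)

lemma disjoint_dyadic_annuli: "disjoint_family dyadic_annulus"
  unfolding disjoint_family_on_def
proof (intro ballI impI)
  have *: "dyadic_annulus i \<inter> dyadic_annulus j = {}" if "i < j" for i j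
  proof -
    have "((1::real)/2) ^ j \<le> (1/2) ^ Suc i" using that by (intro power_decreasing) auto
    then show ?thesis by (auto simp: dyadic_annulus_def)
  qed
  fix i j :: nat assume "i \<noteq> j"
  then show "dyadic_annulus i \<inter> dyadic_annulus j = {}"
    using *[of i j] *[of j i] by (cases "i < j") auto
qed

text \<open>
  With \<open>d = 2 ^ (-j)\<close> the area is \<open>pi * d * (1 - 3/4 * d)\<close>. The bound
  \<open>1 \<le> j\<close> keeps the last factor at least \<open>1/2\<close>.
\<close>

lemma measure_dyadic_annulus:
  assumes "1 \<le> j"
  shows "(1/2) ^ j \<le> measure lborel (dyadic_annulus j)" "measure lborel (dyadic_annulus j) \<le> 4"
    "emeasure lborel (dyadic_annulus j) < \<infinity>"
proof -
  define d :: real where "d = (1/2) ^ j"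
  have "d \<le> (1/2) ^ 1" unfolding d_def using assms by (intro power_decreasing) auto
  then have d: "0 < d" "d \<le> 1/2" by (auto simp: d_def)
  have eq: "dyadic_annulus j = cball 0 (1 - d/2) - cball 0 (1 - d)"
    by (simp add: dyadic_annulus_eq_Diff d_def)
  have "measure lborel (dyadic_annulus j) =
      measure lborel (cball (0::complex) (1 - d/2)) - measure lborel (cball (0::complex) (1 - d))"
    unfolding eq using d emeasure_lborel_cball_finite[of "0::complex" "1 - d/2"]
    by (subst measure_Diff) auto
  also have "\<dots> = pi * (d * (1 - 3/4 * d))"
    using d by (simp add: content_disc power2_eq_square algebra_simps)
  finally have m: "measure lborel (dyadic_annulus j) = pi * (d * (1 - 3/4 * d))" .
  have "d * (1/2) \<le> d * (1 - 3/4 * d)" using d by (intro mult_left_mono) auto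
  then have "2 * (d * (1/2)) \<le> pi * (d * (1 - 3/4 * d))"
    using pi_ge_two d by (intro mult_mono) auto
  then show "(1/2) ^ j \<le> measure lborel (dyadic_annulus j)" by (simp add: m d_def)
  have "d * (1 - 3/4 * d) \<le> 1 * 1" using d by (intro mult_mono) auto
  then have "pi * (d * (1 - 3/4 * d)) \<le> 4 * 1" using d pi_less_4 by (intro mult_mono) auto
  then show "measure lborel (dyadic_annulus j) \<le> 4" by (simp add: m)
  have "emeasure lborel (dyadic_annulus j) \<le> emeasure lborel (cball (0::complex) 1)"
    using dyadic_annulus_subset_cball[of j] by (intro emeasure_mono) (auto simp: dyadic_annulus_def)
  then show "emeasure lborel (dyadic_annulus j) < \<infinity>"
    using emeasure_lborel_cball_finite[of "0::complex" 1] by (auto simp: order_le_less_trans)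
qed

text \<open>
  By Bernoulli's inequality \<open>1 - d\<close> with \<open>d = 2 ^ (-j)\<close> still has its power of exponent
  \<open>2 ^ (j - 1)\<close> at least \<open>1/2\<close>, and \<open>2 * k\<close> is at most eight times this
  exponent.
\<close>

lemma dyadic_annulus_power_ge:
  assumes "z \<in> dyadic_annulus j" "1 \<le> j" "k < 2 ^ Suc j"
  shows "1 / 256 \<le> cmod z ^ (2 * k)"
proof -
  define d :: real where "d = (1/2) ^ j"
  have "d \<le> (1/2) ^ 1" unfolding d_def using assms by (intro power_decreasing) auto
  then have d: "0 < d" "d \<le> 1/2" by (auto simp: d_def)
  obtain i where i: "j = Suc i" using assms by (cases j) auto
  have "real (2 ^ i) * d = 1 / 2" by (simp add: d_def i power_divide)
  then have "1 / 2 \<le> (1 - d) ^ (2 ^ i)"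
    using Bernoulli_inequality[of "- d" "2 ^ i"] d by simp
  then have "(1 / 2) ^ 8 \<le> ((1 - d) ^ (2 ^ i)) ^ 8" by (intro power_mono) auto
  also have "\<dots> = (1 - d) ^ (2 ^ i * 8)" by (simp add: power_mult)
  also have "\<dots> \<le> (1 - d) ^ (2 * k)" using assms d by (intro power_decreasing) (auto simp: i)
  also have "\<dots> \<le> cmod z ^ (2 * k)"
    using assms d by (intro power_mono) (auto simp: d_def dyadic_annulus_def)
  finally show ?thesis by (simp add: power_divide)
qed

definition taylor_coeff :: "(complex \<Rightarrow> complex) \<Rightarrow> nat \<Rightarrow> complex"
  where "taylor_coeff g k = (deriv ^^ k) g 0 / fact k"

lemma continuous_on_disc_subset:
  assumes "g holomorphic_on unit_disc" "K \<subseteq> unit_disc"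
  shows "continuous_on K g"
  using assms holomorphic_on_imp_continuous_on holomorphic_on_subset by blast

text \<open>
  Bessel's inequality on the annulus bounds \<open>d\<close> times the sum of the squares of the coefficients in the
  block, since the monomials of the block are bounded below there and the area is at least
  \<open>d = 2 ^ (-j)\<close>. The Cauchy-Schwarz inequality for the \<open>2 ^ j\<close> terms and the factors
  \<open>1 / (k + 1) \<le> d\<close> do the rest.
\<close>

lemma dyadic_block_square_le:
  assumes g: "g holomorphic_on unit_disc" and j: "1 \<le> j"
  shows "(\<Sum>k\<in>{2^j..<2^Suc j}. cmod (taylor_coeff g k) / real (Suc k))\<^sup>2 \<le>
    256 * (LINT z:dyadic_annulus j|lborel. (cmod (g z))\<^sup>2)"
proof -
  define d :: real where "d = (1/2) ^ j"
  define K where "K = {2^j..<2^Suc j :: nat}"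
  let ?b = "\<lambda>k. cmod (taylor_coeff g k)"
  have d: "0 < d" "d \<le> 1" by (auto simp: d_def power_le_one)
  have cardK: "real (card K) = 1 / d" by (simp add: K_def d_def power_divide)
  have sub: "dyadic_annulus j \<subseteq> cball 0 (1 - d / 2)"
    using dyadic_annulus_subset_cball[of j] by (simp add: d_def)
  have disc: "cball 0 (1 - d / 2) \<subseteq> unit_disc" using d by auto
  have w: "d / 256 \<le> (LINT z:dyadic_annulus j|lborel. cmod z ^ (2 * k))" if "k \<in> K" for k
  proof -
    have "d / 256 \<le> (LINT z:dyadic_annulus j|lborel. 1 / 256 :: real)"
      using measure_dyadic_annulus[OF j] by (simp add: set_lebesgue_integral_def d_def)
    also have "\<dots> \<le> (LINT z:dyadic_annulus j|lborel. cmod z ^ (2 * k))"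
      using dyadic_annulus_power_ge[OF _ j, of _ k] that
      by (intro set_integral_mono set_integrable_compact_subset[OF compact_cball _ _ sub] continuous_intros)
         (auto simp: K_def)
    finally show ?thesis .
  qed
  have "d / 256 * (\<Sum>k\<in>K. (?b k)\<^sup>2) = (\<Sum>k\<in>K. (?b k)\<^sup>2 * (d / 256))"
    by (simp add: sum_distrib_left mult.commute)
  also have "\<dots> \<le> (\<Sum>k\<in>K. (?b k)\<^sup>2 * (LINT z:dyadic_annulus j|lborel. cmod z ^ (2 * k)))"
    by (intro sum_mono mult_left_mono w) auto
  also have "\<dots> \<le> (LINT z:dyadic_annulus j|lborel. (cmod (g z))\<^sup>2)"
  proof (rule bessel_inequality_rotation_invariant[OF _ rotation_invariant_dyadic_annulus sub])
    show "summable (\<lambda>m. ?b m * (1 - d / 2) ^ m)"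
      unfolding taylor_coeff_def using holomorphic_power_series_summable_norm[OF g, of "1 - d / 2"] d
      by simp
    show "continuous_on (cball 0 (1 - d / 2)) g"
      by (rule continuous_on_disc_subset[OF g disc])
    show "(\<lambda>m. taylor_coeff g m * z ^ m) sums g z" if "z \<in> dyadic_annulus j" for z
      using holomorphic_power_series[OF g, of z] that sub disc by (auto simp: taylor_coeff_def)
  qed (use d in \<open>auto simp: K_def\<close>)
  finally have bessel: "d / 256 * (\<Sum>k\<in>K. (?b k)\<^sup>2) \<le> (LINT z:dyadic_annulus j|lborel. (cmod (g z))\<^sup>2)" .
  have "(\<Sum>k\<in>K. ?b k / real (Suc k)) \<le> (\<Sum>k\<in>K. d * ?b k)"
  proof (rule sum_mono)
    fix k assume "k \<in> K"
    then have "2 ^ j \<le> Suc k" by (simp add: K_def)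
    then have "real (2 ^ j) \<le> real (Suc k)" by (rule of_nat_mono)
    then have "d * real (2 ^ j) \<le> d * real (Suc k)" using d by (intro mult_left_mono) simp_all
    then have "1 \<le> d * real (Suc k)" by (simp add: d_def power_divide)
    then have "?b k * 1 \<le> ?b k * (d * real (Suc k))" by (intro mult_left_mono) auto
    then show "?b k / real (Suc k) \<le> d * ?b k"
      by (simp add: pos_divide_le_eq mult_ac del: of_nat_Suc)
  qed
  then have "(\<Sum>k\<in>K. ?b k / real (Suc k))\<^sup>2 \<le> (\<Sum>k\<in>K. d * ?b k)\<^sup>2"
    by (intro power_mono sum_nonneg) auto
  also have "\<dots> = d\<^sup>2 * (\<Sum>k\<in>K. ?b k)\<^sup>2"
    by (simp add: power_mult_distrib flip: sum_distrib_left)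
  also have "\<dots> \<le> d\<^sup>2 * ((\<Sum>k\<in>K. (?b k)\<^sup>2) * real (card K))"
    by (intro mult_left_mono sum_squared_le_sum_of_squares) auto
  also have "\<dots> = 256 * (d / 256 * (\<Sum>k\<in>K. (?b k)\<^sup>2))"
    using d by (simp add: cardK power2_eq_square)
  also have "\<dots> \<le> 256 * (LINT z:dyadic_annulus j|lborel. (cmod (g z))\<^sup>2)"
    using bessel by simp
  finally show ?thesis by (simp add: K_def)
qed

section \<open>From square integrals to the Besov integral\<close>

text \<open>
  The discs of radius \<open>d / 4\<close>, \<open>d = 2 ^ (-i-1)\<close>, about the points of the annulus of index
  \<open>i + 1\<close> stay in the union of this annulus and its two neighbours.
\<close>

definition fat_annulus :: "nat \<Rightarrow> complex set"
  where "fat_annulus i = dyadic_annulus i \<union> dyadic_annulus (i + 1) \<union> dyadic_annulus (i + 2)"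

lemma mem_fat_annulus_iff:
  "z \<in> fat_annulus i \<longleftrightarrow> (1/2) ^ Suc i / 4 \<le> 1 - cmod z \<and> 1 - cmod z < 2 * (1/2) ^ Suc i"
  by (auto simp: fat_annulus_def dyadic_annulus_def)

lemma sets_fat_annulus [measurable, simp]: "fat_annulus i \<in> sets borel"
  by (simp add: fat_annulus_def)

lemma fat_annulus_subset_cball: "fat_annulus i \<subseteq> cball 0 (1 - (1/2) ^ Suc i / 4)"
  by (auto simp: mem_fat_annulus_iff)

text \<open>
  Apply the mean value inequality to the disc of radius \<open>d / 4\<close> about \<open>z\<close>; the factor 16
  comes from this radius.
\<close>

lemma pointwise_le_fat_annulus_integral:
  assumes g: "g holomorphic_on unit_disc" and p: "1 \<le> p" and z: "z \<in> dyadic_annulus (Suc i)"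
  shows "cmod (g z) powr p \<le> 16 / ((1/2) ^ Suc i)\<^sup>2 * (LINT w:fat_annulus i|lborel. cmod (g w) powr p)"
proof -
  define d :: real where "d = (1/2) ^ Suc i"
  have "d \<le> (1/2) ^ 1" unfolding d_def by (intro power_decreasing) auto
  then have d: "0 < d" "d \<le> 1/2" by (auto simp: d_def)
  have zd: "d / 2 \<le> 1 - cmod z" "1 - cmod z < d" using z by (auto simp: dyadic_annulus_def d_def)
  have sub: "cball z (d / 4) \<subseteq> fat_annulus i"
  proof
    fix w assume w: "w \<in> cball z (d / 4)"
    then have "cmod (z - w) \<le> d / 4" by (simp add: dist_norm)
    moreover have "\<bar>cmod z - cmod w\<bar> \<le> cmod (z - w)" by (rule norm_triangle_ineq3)
    ultimately show "w \<in> fat_annulus i"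
      using zd d unfolding mem_fat_annulus_iff d_def[symmetric] by auto
  qed
  have hol: "g holomorphic_on ball z (d / 2)"
  proof (rule holomorphic_on_subset[OF g], rule subsetI)
    fix w assume "w \<in> ball z (d / 2)"
    then show "w \<in> unit_disc" using zd norm_triangle_ineq2[of w z] by (auto simp: dist_norm norm_minus_commute)
  qed
  have int: "set_integrable lborel (fat_annulus i) (\<lambda>w. cmod (g w) powr p)"
  proof (rule set_integrable_compact_subset[OF compact_cball continuous_on_norm_powr _ fat_annulus_subset_cball])
    show "continuous_on (cball 0 (1 - (1/2) ^ Suc i / 4)) g"
      unfolding d_def[symmetric] by (rule continuous_on_disc_subset[OF g]) (use d in auto)
  qed (use p in auto)
  have "d\<^sup>2 / 16 * cmod (g z) powr p \<le> pi * (d / 4)\<^sup>2 * cmod (g z) powr p"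
  proof -
    have "1 * (d / 4)\<^sup>2 \<le> pi * (d / 4)\<^sup>2" using pi_ge_two by (intro mult_right_mono) auto
    then show ?thesis by (intro mult_right_mono) (auto simp: power_divide)
  qed
  also have "\<dots> \<le> (LINT w:cball z (d/4)|lborel. cmod (g w) powr p)"
    using d p by (intro holomorphic_area_mean_value[OF hol]) auto
  also have "\<dots> \<le> (LINT w:fat_annulus i|lborel. cmod (g w) powr p)"
    by (rule set_integral_mono_set) (use int sub in auto)
  finally show ?thesis unfolding d_def[symmetric] using d by (simp add: field_simps)
qed

lemma set_integrable_fat_annulus:
  fixes h :: "complex \<Rightarrow> 'a::{banach, second_countable_topology}"
  assumes "continuous_on unit_disc h" "S \<in> sets borel" "S \<subseteq> fat_annulus i"
  shows "set_integrable lborel S h"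
proof (rule set_integrable_compact_subset[OF compact_cball _ assms(2)])
  show "S \<subseteq> cball 0 (1 - (1/2) ^ Suc i / 4)"
    using assms(3) fat_annulus_subset_cball by blast
  define e :: real where "e = (1/2) ^ Suc i"
  have "0 < e" by (simp add: e_def)
  then have "cball 0 (1 - e / 4) \<subseteq> unit_disc" by auto
  then show "continuous_on (cball 0 (1 - (1/2) ^ Suc i / 4)) h"
    unfolding e_def using assms(1) continuous_on_subset by blast
qed

text \<open>
  For \<open>p \<ge> 2\<close> the power mean inequality suffices, the area being at most 4. For \<open>p < 2\<close>
  the square \<open>\<bar>g\<bar>\<^sup>2\<close> is at most \<open>\<bar>g\<bar>\<close> to the power
  \<open>p\<close> times the power \<open>2 - p\<close> of the supremum over the annulus. The mean value inequality
  controls that supremum by the same integral over the larger annulus, and this costs the factor with the negative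
  exponent \<open>p - 2\<close>.
\<close>

lemma annulus_square_integral_powr_le:
  assumes g: "g holomorphic_on unit_disc" and p: "1 < p"
  shows "(LINT z:dyadic_annulus (Suc i)|lborel. (cmod (g z))\<^sup>2) powr (p / 2) \<le>
    4 powr \<bar>p - 2\<bar> * ((1/2) ^ Suc i) powr min (p - 2) 0 *
    (LINT z:fat_annulus i|lborel. cmod (g z) powr p)"
proof -
  define d :: real where "d = (1/2) ^ Suc i"
  have d: "0 < d" by (simp add: d_def)
  define D where "D = (LINT z:dyadic_annulus (Suc i)|lborel. (cmod (g z))\<^sup>2)"
  define G where "G = (LINT z:fat_annulus i|lborel. cmod (g z) powr p)"
  have contg: "continuous_on unit_disc g"
    by (rule continuous_on_disc_subset[OF g order_refl])
  have sub: "dyadic_annulus (Suc i) \<subseteq> fat_annulus i" by (auto simp: fat_annulus_def)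
  have cont: "continuous_on unit_disc (\<lambda>z. cmod (g z) powr p)"
    using p by (intro continuous_on_norm_powr contg) auto
  have intR: "set_integrable lborel (dyadic_annulus (Suc i)) (\<lambda>z. cmod (g z) powr p)"
    "set_integrable lborel (dyadic_annulus (Suc i)) (\<lambda>z. (cmod (g z))\<^sup>2)"
    by (intro set_integrable_fat_annulus[OF _ _ sub] cont continuous_intros contg; simp)+
  have G0: "0 \<le> G" "0 \<le> D"
    by (auto simp: G_def D_def set_lebesgue_integral_def intro!: Bochner_Integration.integral_nonneg)
  have RG: "(LINT z:dyadic_annulus (Suc i)|lborel. cmod (g z) powr p) \<le> G"
    unfolding G_def by (rule set_integral_mono_set[OF set_integrable_fat_annulus[OF cont]]) (use sub in auto)
  have "D powr (p / 2) \<le> 4 powr \<bar>p - 2\<bar> * d powr min (p - 2) 0 * G"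
  proof (cases "p < 2")
    case True
    define M where "M = 16 / d\<^sup>2 * G"
    have M0: "0 \<le> M" using G0 by (simp add: M_def)
    have pt: "(cmod (g z))\<^sup>2 \<le> M powr ((2 - p) / p) * cmod (g z) powr p"
      if "z \<in> dyadic_annulus (Suc i)" for z
    proof (cases "g z = 0")
      case False
      have "cmod (g z) powr p \<le> M"
        using pointwise_le_fat_annulus_integral[OF g _ that, of p] p by (simp add: M_def G_def d_def)
      then have "(cmod (g z) powr p) powr ((2 - p) / p) \<le> M powr ((2 - p) / p)"
        using True p by (intro powr_mono2) auto
      then have "cmod (g z) powr (2 - p) \<le> M powr ((2 - p) / p)"
        using p by (simp add: powr_powr)
      then have "cmod (g z) powr (2 - p) * cmod (g z) powr p \<le> M powr ((2 - p) / p) * cmod (g z) powr p"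
        by (intro mult_right_mono) auto
      then show ?thesis using False by (simp flip: powr_add powr_numeral)
    qed simp
    have "D \<le> (LINT z:dyadic_annulus (Suc i)|lborel. M powr ((2 - p) / p) * cmod (g z) powr p)"
      unfolding D_def using pt by (intro set_integral_mono intR set_integrable_mult_right impI) auto
    also have "\<dots> \<le> M powr ((2 - p) / p) * G"
      using RG by (simp add: mult_left_mono)
    finally have "D powr (p / 2) \<le> (M powr ((2 - p) / p) * G) powr (p / 2)"
      using p G0 by (intro powr_mono2) auto
    also have "\<dots> = M powr ((2 - p) / 2) * G powr (p / 2)"
      using p by (simp add: powr_mult powr_powr)
    also have "M = 16 * (G * d powr - 2)"
      using d by (simp add: M_def powr_minus divide_inverse)
    also have "(16 * (G * d powr - 2)) powr ((2 - p) / 2) * G powr (p / 2) =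
        16 powr ((2 - p) / 2) * (d powr - 2) powr ((2 - p) / 2) * (G powr ((2 - p) / 2) * G powr (p / 2))"
      using G0 by (simp only: powr_mult mult_ac)
    also have "G powr ((2 - p) / 2) * G powr (p / 2) = G"
    proof -
      have "(2 - p) / 2 + p / 2 = 1" by (simp add: diff_divide_distrib)
      then show ?thesis using G0 by (simp only: powr_add[symmetric] powr_one)
    qed
    also have "(16::real) powr ((2 - p) / 2) = 4 powr (2 - p)"
      using powr_powr[of 4 2 "(2 - p) / 2"] by simp
    also have "(d powr - 2) powr ((2 - p) / 2) = d powr (p - 2)"
    proof -
      have "- 2 * ((2 - p) / 2) = p - 2" by simp
      then show ?thesis by (simp only: powr_powr)
    qed
    finally show ?thesis using True by (simp add: abs_if min_def)
  next
    case False
    define A where "A = measure lborel (dyadic_annulus (Suc i))"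
    have "d \<le> A" "A \<le> 4"
      using measure_dyadic_annulus[of "Suc i"] by (auto simp: A_def d_def)
    with d have A: "0 < A" "A \<le> 4" by auto
    have sq: "((cmod (g z))\<^sup>2) powr (p / 2) = cmod (g z) powr p" for z
      using powr_powr[of "cmod (g z)" 2 "p / 2"] by simp
    have "D powr (p / 2) \<le> A powr (p / 2 - 1) *
        (LINT z:dyadic_annulus (Suc i)|lborel. ((cmod (g z))\<^sup>2) powr (p / 2))"
      unfolding D_def A_def
      by (rule set_integral_powr_power_mean)
         (use False intR A measure_dyadic_annulus[of "Suc i"] in \<open>auto simp: sq A_def\<close>)
    also have "\<dots> \<le> A powr (p / 2 - 1) * G" using RG by (simp add: sq mult_left_mono)
    also have "A powr (p / 2 - 1) \<le> 4 powr (p / 2 - 1)"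
      using A False by (intro powr_mono2) auto
    also have "(4::real) powr (p / 2 - 1) \<le> 4 powr (p - 2)"
      using False by (intro powr_mono) auto
    finally show ?thesis using False G0 d by (simp add: mult_right_mono)
  qed
  then show ?thesis by (simp add: D_def G_def d_def)
qed

text \<open>
  The integrand of the Besov seminorm, with \<open>g\<close> in the place of the derivative.
\<close>

definition besov_weight :: "real \<Rightarrow> (complex \<Rightarrow> complex) \<Rightarrow> complex \<Rightarrow> real"
  where "besov_weight p g z = (1 - (cmod z)\<^sup>2) powr (p - 2) * cmod (g z) powr p"

lemma continuous_on_besov_weight:
  assumes "g holomorphic_on unit_disc" "0 < p"
  shows "continuous_on unit_disc (besov_weight p g)"
  unfolding besov_weight_def
proof (intro continuous_on_mult continuous_on_norm_powr continuous_on_powr assms(2)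
    continuous_on_disc_subset[OF assms(1)])
  show "\<forall>z\<in>unit_disc. 1 - (cmod z)\<^sup>2 \<noteq> 0"
    by (auto simp: abs_square_eq_1)
qed (auto intro!: continuous_intros)

text \<open>
  On the larger annulus \<open>1 - \<bar>z\<bar>\<^sup>2\<close> lies between \<open>d / 4\<close> and
  \<open>4 * d\<close> for \<open>d = 2 ^ (-i-1)\<close>. The lower bound serves for \<open>p \<ge> 2\<close>, the
  upper one for \<open>p < 2\<close>, where the exponent \<open>p - 2\<close> is negative.
\<close>

lemma fat_annulus_integral_le_besov_weight:
  assumes g: "g holomorphic_on unit_disc" and p: "1 < p"
  shows "((1/2) ^ Suc i) powr (p - 2) * (LINT z:fat_annulus i|lborel. cmod (g z) powr p) \<le>
    4 powr \<bar>p - 2\<bar> * (LINT z:fat_annulus i|lborel. besov_weight p g z)"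
proof -
  define d :: real where "d = (1/2) ^ Suc i"
  have d: "0 < d" by (simp add: d_def)
  have cont: "continuous_on unit_disc (\<lambda>z. cmod (g z) powr p)"
    using p by (intro continuous_on_norm_powr continuous_on_disc_subset[OF g]) auto
  have contW: "continuous_on unit_disc (besov_weight p g)"
    using continuous_on_besov_weight[OF g] p by simp
  have weight: "d powr (p - 2) \<le> 4 powr \<bar>p - 2\<bar> * (1 - (cmod z)\<^sup>2) powr (p - 2)"
    if "z \<in> fat_annulus i" for z
  proof -
    define x where "x = 1 - (cmod z)\<^sup>2"
    have z: "d / 4 \<le> 1 - cmod z" "1 - cmod z < 2 * d"
      using that by (auto simp: mem_fat_annulus_iff d_def)
    have x: "x = (1 - cmod z) * (1 + cmod z)" by (simp add: x_def power2_eq_square algebra_simps)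
    have "(1 - cmod z) * 1 \<le> x" unfolding x using z d by (intro mult_left_mono) auto
    then have lo: "d \<le> 4 * x" using z by simp
    have "x \<le> (1 - cmod z) * 2" unfolding x using z d by (intro mult_left_mono) auto
    then have hi: "x \<le> 4 * d" using z by simp
    have x0: "0 < x" using lo d by simp
    show ?thesis
    proof (cases "p \<ge> 2")
      case True
      then have "d powr (p - 2) \<le> (4 * x) powr (p - 2)" using lo d by (intro powr_mono2) auto
      then have "d powr (p - 2) \<le> 4 powr (p - 2) * x powr (p - 2)"
        using x0 by (simp add: powr_mult)
      then show ?thesis using True by (simp add: x_def)
    next
      case False
      then have "d powr (p - 2) \<le> (x / 4) powr (p - 2)" using hi x0 by (intro powr_mono2') auto
      also have "\<dots> = 4 powr (2 - p) * x powr (p - 2)"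
        using x0 by (simp add: powr_divide powr_minus_divide[of 4 "p - 2", simplified] mult.commute)
      finally show ?thesis using False by (simp add: x_def)
    qed
  qed
  have "(LINT z:fat_annulus i|lborel. d powr (p - 2) * cmod (g z) powr p) \<le>
      (LINT z:fat_annulus i|lborel. 4 powr \<bar>p - 2\<bar> * besov_weight p g z)"
  proof (rule set_integral_mono)
    fix z assume "z \<in> fat_annulus i"
    from mult_right_mono[OF weight[OF this], of "cmod (g z) powr p"]
    show "d powr (p - 2) * cmod (g z) powr p \<le> 4 powr \<bar>p - 2\<bar> * besov_weight p g z"
      by (simp add: besov_weight_def mult_ac)
  qed (auto intro!: set_integrable_mult_right set_integrable_fat_annulus[OF cont] set_integrable_fat_annulus[OF contW])
  then show ?thesis by (simp add: d_def)
qed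

text \<open>
  The powers of \<open>d\<close> from the previous two estimates combine to the exponent
  \<open>min (p - 2) 0 - (p - 2) = - max (p - 2) 0\<close>. For \<open>p \<le> 2\<close> they cancel completely.
\<close>

lemma dyadic_block_powr_le:
  assumes g: "g holomorphic_on unit_disc" and p: "1 < p"
  shows "(\<Sum>k\<in>{2^Suc i..<2^Suc (Suc i)}. cmod (taylor_coeff g k) / real (Suc k)) powr p \<le>
    16 powr p * 16 powr \<bar>p - 2\<bar> * (2 ^ Suc i) powr max (p - 2) 0 *
    (LINT z:fat_annulus i|lborel. besov_weight p g z)"
proof -
  define d :: real where "d = (1/2) ^ Suc i"
  have d: "0 < d" "2 ^ Suc i = 1 / d" by (simp_all add: d_def power_divide)
  define T where "T = (\<Sum>k\<in>{2^Suc i..<2^Suc (Suc i)}. cmod (taylor_coeff g k) / real (Suc k))"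
  define D where "D = (LINT z:dyadic_annulus (Suc i)|lborel. (cmod (g z))\<^sup>2)"
  define G where "G = (LINT z:fat_annulus i|lborel. cmod (g z) powr p)"
  define E where "E = (LINT z:fat_annulus i|lborel. besov_weight p g z)"
  have T0: "0 \<le> T" unfolding T_def by (intro sum_nonneg) auto
  have "T powr p = (T\<^sup>2) powr (p / 2)"
    using T0 powr_powr[of T 2 "p / 2"] by simp
  also have "\<dots> \<le> (256 * D) powr (p / 2)"
    using dyadic_block_square_le[OF g, of "Suc i"] p
    by (intro powr_mono2) (auto simp: T_def D_def)
  also have "\<dots> = 16 powr p * D powr (p / 2)"
    using powr_powr[of 16 2 "p / 2"] by (simp add: powr_mult)
  finally have "T powr p \<le> 16 powr p * D powr (p / 2)" .
  moreover have "D powr (p / 2) \<le> 4 powr \<bar>p - 2\<bar> * (d powr min (p - 2) 0 * G)"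
    using annulus_square_integral_powr_le[OF g p, of i] by (simp add: D_def G_def d_def mult.assoc)
  moreover have "d powr min (p - 2) 0 * G = d powr (- max (p - 2) 0) * (d powr (p - 2) * G)"
  proof -
    have "min (p - 2) 0 = - max (p - 2) 0 + (p - 2)" by (simp add: min_def max_def)
    then show ?thesis using d by (simp only: powr_add mult.assoc)
  qed
  moreover have "d powr (p - 2) * G \<le> 4 powr \<bar>p - 2\<bar> * E"
    using fat_annulus_integral_le_besov_weight[OF g p, of i] by (simp add: G_def E_def d_def)
  ultimately have "T powr p \<le>
      16 powr p * (4 powr \<bar>p - 2\<bar> * (d powr (- max (p - 2) 0) * (4 powr \<bar>p - 2\<bar> * E)))"
    by (smt (verit) mult_left_mono powr_ge_zero)
  also have "\<dots> = 16 powr p * (4 powr \<bar>p - 2\<bar> * 4 powr \<bar>p - 2\<bar>) * d powr (- max (p - 2) 0) * E"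
    by (simp only: mult_ac)
  also have "(4::real) powr \<bar>p - 2\<bar> * 4 powr \<bar>p - 2\<bar> = 16 powr \<bar>p - 2\<bar>"
    by (simp flip: powr_mult)
  also have "d powr (- max (p - 2) 0) = (2 ^ Suc i) powr max (p - 2) 0"
    unfolding d(2) using d(1) by (simp add: powr_divide powr_minus_divide)
  finally show ?thesis by (simp add: T_def E_def)
qed

text \<open>
  Every point of the disc lies in at most three of the larger annuli.
\<close>

lemma summable_fat_annulus_integrals:
  fixes h :: "complex \<Rightarrow> real"
  assumes h: "set_integrable lborel unit_disc h" and h0: "\<And>z. z \<in> unit_disc \<Longrightarrow> 0 \<le> h z"
  shows "summable (\<lambda>i. LINT z:fat_annulus i|lborel. h z)"
proof -
  have sub: "dyadic_annulus i \<subseteq> unit_disc" for i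
  proof -
    have "0 < ((1::real)/2) ^ Suc i" by simp
    then have "cmod z < 1" if "(1/2) ^ Suc i \<le> 1 - cmod z" for z using that by linarith
    then show ?thesis by (auto simp: dyadic_annulus_def simp del: power_Suc)
  qed
  have int: "set_integrable lborel (dyadic_annulus i) h" for i
    by (rule set_integrable_subset[OF h _ sub]) simp
  define e where "e i = (LINT z:dyadic_annulus i|lborel. h z)" for i
  have e: "summable e"
  proof (rule summableI_nonneg_bounded)
    show "0 \<le> e i" for i
      unfolding e_def set_lebesgue_integral_def using h0 sub[of i]
      by (intro Bochner_Integration.integral_nonneg) (auto simp: indicator_def)
    fix n
    have "(\<Sum>i<n. e i) = (LINT z:(\<Union>i<n. dyadic_annulus i)|lborel. h z)"
      unfolding e_def
      by (rule set_integral_finite_Union[symmetric])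
         (use int disjoint_dyadic_annuli in \<open>auto simp: disjoint_family_on_def\<close>)
    also have "\<dots> \<le> (LINT z:unit_disc|lborel. h z)"
      by (rule set_integral_mono_set[OF h]) (use sub h0 in auto)
    finally show "(\<Sum>i<n. e i) \<le> (LINT z:unit_disc|lborel. h z)" .
  qed
  have disj: "dyadic_annulus i \<inter> dyadic_annulus j = {}" if "i \<noteq> j" for i j
    using disjoint_dyadic_annuli that by (auto simp: disjoint_family_on_def)
  have "(LINT z:fat_annulus i|lborel. h z) = e i + e (i + 1) + e (i + 2)" for i
  proof -
    have "(LINT z:fat_annulus i|lborel. h z) =
        (LINT z:dyadic_annulus i \<union> dyadic_annulus (i + 1)|lborel. h z) + e (i + 2)"
      unfolding fat_annulus_def e_def
      by (intro set_integral_Un set_integrable_Un int) (auto simp: Int_Un_distrib2 disj)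
    also have "(LINT z:dyadic_annulus i \<union> dyadic_annulus (i + 1)|lborel. h z) = e i + e (i + 1)"
      unfolding e_def by (intro set_integral_Un int) (auto simp: disj)
    finally show ?thesis .
  qed
  moreover have "summable (\<lambda>i. e i + e (i + 1) + e (i + 2))"
    by (intro summable_add e summable_ignore_initial_segment)
  ultimately show ?thesis by simp
qed

section \<open>Convergence of the moment series\<close>

lemma besov_space_imp_weight_integrable:
  assumes f: "f \<in> besov_space p" and p: "1 < p"
  shows "set_integrable lborel unit_disc (besov_weight p (deriv f))"
proof -
  have hol: "f holomorphic_on unit_disc" and norm: "besov_norm p f < \<infinity>"
    using f by (auto simp: besov_space_def)
  have fin: "x \<noteq> \<infinity>" if "epowr x a < \<infinity>" for x a
    using that by (auto simp: epowr_def)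
  let ?W = "\<lambda>z. indicator unit_disc z *\<^sub>R besov_weight p (deriv f) z"
  have "continuous_on unit_disc (besov_weight p (deriv f))"
    using continuous_on_besov_weight[OF holomorphic_deriv[OF hol]] p by simp
  then have meas: "?W \<in> borel_measurable borel"
    by (intro borel_measurable_continuous_on_indicator) auto
  define I where "I = (\<integral>\<^sup>+z. ennreal (?W z) \<partial>lborel)"
  have "ennreal (cmod (f 0) powr p) + epowr (besov_rho p f) p \<noteq> \<infinity>"
    using norm fin unfolding besov_norm_def by blast
  then have "epowr (besov_rho p f) p < \<infinity>" by (simp add: less_top)
  then have "besov_rho p f \<noteq> \<infinity>" by (rule fin)
  then have "(\<integral>\<^sup>+z\<in>unit_disc. ennreal ((1 - (cmod z)\<^sup>2) powr (p - 2) * cmod (deriv f z) powr p) \<partial>dA) \<noteq> \<infinity>"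
    using fin unfolding besov_rho_def by (simp add: less_top)
  also have "(\<integral>\<^sup>+z\<in>unit_disc. ennreal ((1 - (cmod z)\<^sup>2) powr (p - 2) * cmod (deriv f z) powr p) \<partial>dA) =
      (\<integral>\<^sup>+z. ennreal (?W z) \<partial>dA)"
    by (intro nn_integral_cong) (auto simp: besov_weight_def indicator_def)
  also have "\<dots> = ennreal (1 / pi) * I"
    unfolding dA_def I_def using meas by (intro nn_integral_scale_measure) auto
  finally have "I < \<infinity>"
    by (auto simp: less_top ennreal_mult_eq_top_iff)
  moreover have "norm (?W z) = ?W z" for z
    by (simp add: besov_weight_def indicator_def)
  ultimately show ?thesis
    unfolding set_integrable_def using meas
    by (intro integrableI_bounded) (auto simp: I_def)
qed

text \<open>
  The blocks start at index 2, since the estimates on the annuli of index 1 and higher cover exactly these.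
\<close>

lemma summable_if_summable_dyadic_blocks:
  fixes c :: "nat \<Rightarrow> real"
  assumes c: "\<And>k. 0 \<le> c k" and s: "summable (\<lambda>i. \<Sum>k\<in>{2^Suc i..<2^Suc (Suc i)}. c k)"
  shows "summable c"
proof (rule summableI_nonneg_bounded)
  fix n
  have split: "(\<Sum>k<2^Suc n. c k) = (\<Sum>k<2. c k) + (\<Sum>i<n. \<Sum>k\<in>{2^Suc i..<2^Suc (Suc i)}. c k)"
  proof (induction n)
    case (Suc n)
    have "(\<Sum>k<2^Suc (Suc n). c k) = (\<Sum>k<2^Suc n. c k) + (\<Sum>k\<in>{2^Suc n..<2^Suc (Suc n)}. c k)"
      by (simp add: sum.atLeastLessThan_concat flip: atLeast0LessThan)
    then show ?case by (simp only: Suc sum.lessThan_Suc add.assoc)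
  qed simp
  have "n \<le> 2 ^ Suc n" using less_exp[of "Suc n"] by linarith
  then have "(\<Sum>k<n. c k) \<le> (\<Sum>k<2^Suc n. c k)" by (intro sum_mono2) (auto intro: c)
  also have "\<dots> \<le> (\<Sum>k<2. c k) + (\<Sum>i. \<Sum>k\<in>{2^Suc i..<2^Suc (Suc i)}. c k)"
    unfolding split by (intro add_left_mono sum_le_suminf s sum_nonneg ballI c) auto
  finally show "(\<Sum>k<n. c k) \<le> (\<Sum>k<2. c k) + (\<Sum>i. \<Sum>k\<in>{2^Suc i..<2^Suc (Suc i)}. c k)" .
qed (rule c)

lemma fps_expansion_Suc_eq_taylor_coeff_deriv:
  "fps_nth (fps_expansion f 0) (Suc k) = taylor_coeff (deriv f) k / of_nat (Suc k)"
  by (simp add: fps_expansion_def taylor_coeff_def funpow_Suc_right del: funpow.simps of_nat_Suc)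

text \<open>
  The relation between \<open>q\<close> and \<open>p\<close> covers both cases of the theorem: it holds for
  \<open>q = 1\<close> if \<open>p \<le> 2\<close> and for \<open>q = p' / p\<close> if \<open>p > 2\<close>. It says
  that condensing the series of \<open>m k powr p' / k powr q\<close> produces exactly the power of
  \<open>2 ^ j\<close> that Young's inequality requires to absorb the loss in the bound for the coefficient blocks.
\<close>

lemma besov_series_absolutely_summable:
  fixes m :: "nat \<Rightarrow> real"
  assumes f: "f \<in> besov_space p" and p: "1 < p" and conj: "1 / p + 1 / p' = 1"
    and m: "decseq m" "\<And>n. 0 \<le> m n"
    and q: "0 \<le> q" "1 - q = max (p - 2) 0 * p' / p"
    and s: "summable (\<lambda>k. m (Suc k) powr p' / real (Suc k) powr q)"
  shows "summable (\<lambda>k. m k * cmod (fps_nth (fps_expansion f 0) k))"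
proof -
  define \<kappa> where "\<kappa> = max (p - 2) 0"
  define g where "g = deriv f"
  define N where "N i = (2::real) ^ Suc i" for i
  define T where "T i = (\<Sum>k\<in>{2^Suc i..<2^Suc (Suc i)}. cmod (taylor_coeff g k) / real (Suc k))" for i
  define E where "E i = (LINT z:fat_annulus i|lborel. besov_weight p g z)" for i
  define C where "C = 16 powr p * 16 powr \<bar>p - 2\<bar>"
  have N: "0 < N i" for i by (simp add: N_def)
  have hol: "g holomorphic_on unit_disc"
    using f by (auto simp: g_def besov_space_def intro: holomorphic_deriv)
  have p': "1 < p'"
  proof -
    have "1 / p' = 1 - 1 / p" using conj by simp
    moreover have "0 < 1 - 1 / p" "1 - 1 / p < 1" using p by auto
    ultimately have "0 < 1 / p'" "1 / p' < 1" by auto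
    then show ?thesis by (auto simp: divide_less_eq split: if_splits)
  qed
  have T0: "0 \<le> T i" for i unfolding T_def by (intro sum_nonneg) auto
  have sumE: "summable E"
    unfolding E_def
  proof (rule summable_fat_annulus_integrals)
    show "set_integrable lborel unit_disc (besov_weight p g)"
      unfolding g_def by (rule besov_space_imp_weight_integrable[OF f p])
  qed (simp add: besov_weight_def)
  have TE: "T i powr p \<le> C * N i powr \<kappa> * E i" for i
    using dyadic_block_powr_le[OF hol p, of i] by (simp add: T_def C_def N_def \<kappa>_def E_def)
  have "summable (\<lambda>n. 2 ^ n * (m (2 ^ n) powr p' / real (2 ^ n) powr q))"
  proof (subst condensation_test[symmetric])
    show "summable (\<lambda>n. m n powr p' / real n powr q)"
      using s by (subst summable_Suc_iff[symmetric])
    show "m (Suc n) powr p' / real (Suc n) powr q \<le> m n powr p' / real n powr q" if "0 < n" for n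
      using that p' q m by (intro frac_le powr_mono2) (auto simp: decseq_Suc_iff)
  qed auto
  then have "summable (\<lambda>i. 2 ^ Suc i * (m (2 ^ Suc i) powr p' / real (2 ^ Suc i) powr q))"
    by (subst summable_Suc_iff)
  also have "(\<lambda>i. 2 ^ Suc i * (m (2 ^ Suc i) powr p' / real (2 ^ Suc i) powr q)) =
      (\<lambda>i. m (2 ^ Suc i) powr p' * N i powr (1 - q))"
  proof
    fix i
    have "real (2 ^ Suc i) = N i" by (simp add: N_def)
    then show "2 ^ Suc i * (m (2 ^ Suc i) powr p' / real (2 ^ Suc i) powr q) =
        m (2 ^ Suc i) powr p' * N i powr (1 - q)"
      using N[of i] by (simp only: powr_diff) (simp add: N_def)
  qed
  finally have sumM: "summable (\<lambda>i. m (2 ^ Suc i) powr p' * N i powr (1 - q))" .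
  have block: "m (2 ^ Suc i) * T i \<le> m (2 ^ Suc i) powr p' * N i powr (1 - q) + C * E i" for i
  proof -
    \<comment> \<open>the powers of N move the weight between the two factors before the inequality of Young\<close>
    define x where "x = m (2 ^ Suc i) * N i powr (\<kappa> / p)"
    define y where "y = T i * N i powr (- \<kappa> / p)"
    have xy: "0 \<le> x" "0 \<le> y" using m T0 by (auto simp: x_def y_def)
    have "m (2 ^ Suc i) * T i = x * y"
      using N[of i] by (simp add: x_def y_def powr_minus field_simps)
    also have "\<dots> \<le> x powr p' / p' + y powr p / p"
      using Youngs_inequality[OF p' p _ xy] conj by simp
    also have "\<dots> \<le> x powr p' / 1 + y powr p / 1"
      using p p' by (intro add_mono divide_left_mono) auto
    also have "x powr p' = m (2 ^ Suc i) powr p' * N i powr (1 - q)"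
      using m q by (simp add: x_def powr_mult powr_powr \<kappa>_def)
    also have "y powr p = T i powr p * N i powr (- \<kappa>)"
      using T0 p by (simp add: y_def powr_mult powr_powr)
    also have "T i powr p * N i powr (- \<kappa>) \<le> (C * N i powr \<kappa> * E i) * N i powr (- \<kappa>)"
      by (intro mult_right_mono TE) auto
    also have "\<dots> = C * E i" using N[of i] by (simp add: powr_minus)
    finally show ?thesis by simp
  qed
  have major: "summable (\<lambda>k. m k * (cmod (taylor_coeff g k) / real (Suc k)))"
  proof (rule summable_if_summable_dyadic_blocks, goal_cases)
    case (1 k) show ?case using m by simp
  next
    case 2
    show ?case
    proof (rule summable_comparison_test'[OF summable_add[OF sumM summable_mult[OF sumE, of C]]])
      fix i
      have "(\<Sum>k\<in>{2^Suc i..<2^Suc (Suc i)}. m k * (cmod (taylor_coeff g k) / real (Suc k))) \<le>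
          (\<Sum>k\<in>{2^Suc i..<2^Suc (Suc i)}. m (2 ^ Suc i) * (cmod (taylor_coeff g k) / real (Suc k)))"
        by (intro sum_mono mult_right_mono decseqD[OF m(1)]) auto
      also have "\<dots> = m (2 ^ Suc i) * T i" by (simp only: T_def sum_distrib_left)
      also note block
      finally have "(\<Sum>k\<in>{2^Suc i..<2^Suc (Suc i)}. m k * (cmod (taylor_coeff g k) / real (Suc k))) \<le>
          m (2 ^ Suc i) powr p' * N i powr (1 - q) + C * E i" .
      moreover have "0 \<le> (\<Sum>k\<in>{2^Suc i..<2^Suc (Suc i)}. m k * (cmod (taylor_coeff g k) / real (Suc k)))"
        using m by (intro sum_nonneg) auto
      ultimately show "norm (\<Sum>k\<in>{2^Suc i..<2^Suc (Suc i)}. m k * (cmod (taylor_coeff g k) / real (Suc k))) \<le>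
          m (2 ^ Suc i) powr p' * N i powr (1 - q) + C * E i" by (simp only: real_norm_def abs_of_nonneg)
    qed
  qed
  have "summable (\<lambda>k. m (Suc k) * cmod (fps_nth (fps_expansion f 0) (Suc k)))"
  proof (rule summable_comparison_test'[OF major])
    show "norm (m (Suc k) * cmod (fps_nth (fps_expansion f 0) (Suc k))) \<le>
        m k * (cmod (taylor_coeff g k) / real (Suc k))" for k
      unfolding fps_expansion_Suc_eq_taylor_coeff_deriv g_def[symmetric]
      using m decseq_SucD[OF m(1), of k] by (simp add: norm_divide abs_mult divide_right_mono mult_right_mono del: of_nat_Suc)
  qed
  then show ?thesis by (subst (asm) summable_Suc_iff)
qed

lemma
  fixes \<mu> :: "real measure"
  assumes sets: "sets \<mu> = sets (restrict_space borel {0..<1})" and fin: "finite_measure \<mu>"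
  shows moment_nonneg: "0 \<le> moment \<mu> n" and moment_decseq: "decseq (moment \<mu>)"
proof -
  interpret finite_measure \<mu> by fact
  have space: "space \<mu> = {0..<1}"
    using sets_eq_imp_space_eq[OF sets] by (simp add: space_restrict_space)
  have meas: "(\<lambda>t. t ^ n) \<in> borel_measurable \<mu>" for n
    unfolding measurable_cong_sets[OF sets refl] by (intro measurable_restrict_space1) measurable
  have int: "integrable \<mu> (\<lambda>t. t ^ n)" for n
    by (rule integrable_const_bound[of _ 1, OF AE_I2 meas]) (auto simp: space power_le_one)
  show "0 \<le> moment \<mu> n"
    unfolding moment_def by (intro Bochner_Integration.integral_nonneg) (auto simp: space)
  show "decseq (moment \<mu>)"
    unfolding moment_def
    by (intro decseq_SucI integral_mono int) (auto simp: space mult_left_le_one_le)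
qed

section \<open>The Hankel operator\<close>

text \<open>
  Since \<open>\<mu>\<^sub>n\<^sub>+\<^sub>k \<le> \<mu>\<^sub>k\<close>, the given series dominates every inner
  series. The coefficients of the image are thus bounded by its sum, which makes the outer series converge in the
  disc.
\<close>

lemma hankel_well_defined_at_if_absolutely_summable:
  assumes m: "decseq (moment \<mu>)" "\<And>n. 0 \<le> moment \<mu> n"
    and s: "summable (\<lambda>k. moment \<mu> k * cmod (fps_nth (fps_expansion f 0) k))"
  shows "hankel_well_defined_at \<mu> f"
proof -
  define c where "c n = (\<Sum>k. hankel_coeff_term \<mu> f n k)" for n
  have le: "norm (hankel_coeff_term \<mu> f n k) \<le> moment \<mu> k * cmod (fps_nth (fps_expansion f 0) k)" for n k
    using m decseqD[OF m(1), of k "n + k"]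
    by (auto simp: hankel_coeff_term_def norm_mult intro: mult_right_mono)
  have inner: "summable (\<lambda>k. norm (hankel_coeff_term \<mu> f n k))" for n
    by (rule summable_comparison_test'[OF s]) (use le in auto)
  define B where "B = (\<Sum>k. moment \<mu> k * cmod (fps_nth (fps_expansion f 0) k))"
  have c: "cmod (c n) \<le> B" for n
  proof -
    have "cmod (c n) \<le> (\<Sum>k. norm (hankel_coeff_term \<mu> f n k))"
      unfolding c_def by (rule summable_norm[OF inner])
    also have "\<dots> \<le> B" unfolding B_def by (rule suminf_le[OF le inner s])
    finally show ?thesis .
  qed
  have outer: "summable (\<lambda>n. c n * z ^ n)" if "z \<in> unit_disc" for z
  proof (rule summable_comparison_test')
    show "summable (\<lambda>n. B * cmod z ^ n)"
      using that by (intro summable_mult summable_geometric) auto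
    show "norm (c n * z ^ n) \<le> B * cmod z ^ n" for n
      using c by (simp add: norm_mult norm_power mult_right_mono)
  qed
  have "hankel_op \<mu> f holomorphic_on ball 0 1"
    by (rule power_series_holomorphic[of _ _ c])
       (use outer in \<open>simp add: hankel_op_def summable_sums flip: c_def\<close>)
  then show ?thesis
    unfolding hankel_well_defined_at_def using inner outer
    by (auto simp: c_def intro: summable_norm_cancel)
qed

theorem theorem3p5:
  fixes \<mu> :: "real measure" and p p' :: real
  assumes "sets \<mu> = sets (restrict_space borel {0..<1})"
    and "finite_measure \<mu>"
    and "1 < p"
    and "1 / p + 1 / p' = 1"
  shows "(p \<le> 2 \<and> summable (\<lambda>k. moment \<mu> (Suc k) powr p' / real (Suc k))
            \<longrightarrow> hankel_well_defined_in \<mu> (besov_space p)) \<and>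
         (2 < p \<and> summable (\<lambda>k. moment \<mu> (Suc k) powr p' / real (Suc k) powr (p' / p))
            \<longrightarrow> hankel_well_defined_in \<mu> (besov_space p))"
proof -
  note m = moment_decseq[OF assms(1,2)] moment_nonneg[OF assms(1,2)]
  have wd: "hankel_well_defined_in \<mu> (besov_space p)"
    if "0 \<le> q" "1 - q = max (p - 2) 0 * p' / p"
      "summable (\<lambda>k. moment \<mu> (Suc k) powr p' / real (Suc k) powr q)" for q
    unfolding hankel_well_defined_in_def
    using hankel_well_defined_at_if_absolutely_summable[OF m]
      besov_series_absolutely_summable[OF _ assms(3,4) m that] by blast
  have p': "p' \<noteq> 0" "p = (p - 1) * p'"
    using assms(3,4) by (cases "p' = 0"; simp add: field_simps)+
  show ?thesis
  proof (intro conjI impI; elim conjE)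
    assume "p \<le> 2" "summable (\<lambda>k. moment \<mu> (Suc k) powr p' / real (Suc k))"
    then show "hankel_well_defined_in \<mu> (besov_space p)"
      by (intro wd[of 1]) auto
  next
    assume "2 < p" and s: "summable (\<lambda>k. moment \<mu> (Suc k) powr p' / real (Suc k) powr (p' / p))"
    have "p' > 0" using p' assms(3) by (smt (verit) zero_less_mult_iff)
    then show "hankel_well_defined_in \<mu> (besov_space p)"
      using s \<open>2 < p\<close> p' by (intro wd[of "p' / p"]) (auto simp: field_simps)
  qed
qed

end
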